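(* Let $z_*\in\mathcal Z$ and let $(z^k)_{k\ge0}$ be a sequence generated by the Implicit Fast OGDA algorithm described in the context, where $(\beta_k)_{k\ge0}$ is a positive and nondecreasing sequence which satisfies $$0\le\sup_{k\ge1}\frac{k(\beta_k-\beta_{k-1})}{\beta_k}<\alpha-2.$$ Then $$\|z^k-z^{k-1}\|=o\Big(\frac1k\Big)\quad\text{as }k\to+\infty$$ and $$\langle z^k-z_*,V(z^k)\rangle=o\Big(\frac{1}{k\beta_k}\Big)\quad\text{and}\quad\|V(z^k)\|=o\Big(\frac{1}{k\beta_k}\Big)\quad\text{as }k\to+\infty.$$
   Context: $\mathcal H$ is a real Hilbert space, $V\colon\mathcal H\to\mathcal H$ is monotone ($\langle x-y,V(x)-V(y)\rangle\ge0$ for all $x,y\in\mathcal H$) and continuous, and $\mathcal Z:=\{z\in\mathcal H: V(z)=0\}$ is assumed nonempty. Implicit Fast OGDA algorithm: let $\alpha>2$, $z^0,z^1\in\mathcal H$, $s>0$, and let $(\beta_k)_{k\ge0}$ be a positive nondecreasing sequence with $0\le\sup_{k\ge1}\frac{k(\beta_k-\beta_{k-1})}{\beta_k}<\alpha-2$. For every $k\ge1$, $z^{k+1}$ is the (unique) element satisfying $$z^{k+1}=z^k+\Big(1-\frac{\alpha}{k+\alpha}\Big)(z^k-z^{k-1})-\frac{s\big(\alpha\beta_k+k(\beta_k-\beta_{k-1})\big)}{2(k+\alpha)}V(z^{k+1})-\frac{sk\beta_{k-1}}{k+\alpha}\big(V(z^{k+1})-V(z^k)\big).$$ *)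

theory Defs
  imports "HOL-Analysis.Analysis" "HOL-Library.Landau_Symbols"
begin

text \<open>The library's \<open>monotone\<close> and \<open>mono\<close> refer to order relations; here monotonicity is that of
  operators on an inner product space.\<close>

definition monotone_operator :: "('a::real_inner \<Rightarrow> 'a) \<Rightarrow> bool" where
  "monotone_operator V \<longleftrightarrow> (\<forall>x y. inner (x - y) (V x - V y) \<ge> 0)"

definition zeros :: "('a::real_inner \<Rightarrow> 'a) \<Rightarrow> 'a set" where
  "zeros V = {z. V z = 0}"

text \<open>The supremum of reals is unspecified on unbounded sets, so that it is finite has to
  be stated separately.\<close>

definition growth_condition :: "real \<Rightarrow> (nat \<Rightarrow> real) \<Rightarrow> bool" where
  "growth_condition \<alpha> \<beta> \<longleftrightarrow>
     bdd_above ((\<lambda>k. real k * (\<beta> k - \<beta> (k - 1)) / \<beta> k) ` {1..}) \<and>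
     0 \<le> (SUP k\<in>{1..}. real k * (\<beta> k - \<beta> (k - 1)) / \<beta> k) \<and>
     (SUP k\<in>{1..}. real k * (\<beta> k - \<beta> (k - 1)) / \<beta> k) < \<alpha> - 2"

text \<open>The scheme is implicit: \<open>z (k + 1)\<close> also occurs on the right-hand side, so the iteration is a
  relation on sequences rather than a recursive function. The starting points \<open>z 0\<close> and \<open>z 1\<close>
  are arbitrary.\<close>

definition implicit_fast_OGDA ::
  "('a::real_inner \<Rightarrow> 'a) \<Rightarrow> real \<Rightarrow> real \<Rightarrow> (nat \<Rightarrow> real) \<Rightarrow> (nat \<Rightarrow> 'a) \<Rightarrow> bool" where
  "implicit_fast_OGDA V \<alpha> s \<beta> z \<longleftrightarrow>
     (\<forall>k\<ge>1. z (k + 1) =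
        z k + (1 - \<alpha> / (real k + \<alpha>)) *\<^sub>R (z k - z (k - 1))
        - (s * (\<alpha> * \<beta> k + real k * (\<beta> k - \<beta> (k - 1))) / (2 * (real k + \<alpha>))) *\<^sub>R V (z (k + 1))
        - (s * real k * \<beta> (k - 1) / (real k + \<alpha>)) *\<^sub>R (V (z (k + 1)) - V (z k)))"

end

theory Submission
  imports Defs
begin

text \<open>
  Write \<open>x\<^sub>k = z\<^sub>k - z\<^sub>*\<close>, \<open>r\<^sub>k = k (z\<^sub>k - z\<^sub>k\<^sub>-\<^sub>1)\<close> and \<open>q\<^sub>k = s k \<beta>\<^sub>k\<^sub>-\<^sub>1 V(z\<^sub>k)\<close>. The rates amount
  to \<open>r\<^sub>k \<rightarrow> 0\<close> and \<open>q\<^sub>k \<rightarrow> 0\<close>, together with the boundedness of \<open>x\<^sub>k\<close>.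
  Consider \<open>H\<^sub>k = (\<parallel>r\<^sub>k + q\<^sub>k\<parallel>\<^sup>2 + \<parallel>r\<^sub>k\<parallel>\<^sup>2) / 2\<close> and, for a parameter \<open>\<theta>\<close>, the energy
  \<open>G\<^sub>\<theta> = \<theta> (\<alpha> - 1) \<parallel>x\<^sub>k\<parallel>\<^sup>2 + 2 \<theta> \<langle>x\<^sub>k, r\<^sub>k + q\<^sub>k\<rangle> + H\<^sub>k\<close>.

  The origin of \<open>G\<^sub>\<theta>\<close> is the vector \<open>\<theta> x\<^sub>k + r\<^sub>k + q\<^sub>k\<close>, which one step of the scheme changes only by
  \<open>- \<mu> (z\<^sub>k\<^sub>+\<^sub>1 - z\<^sub>k)\<close> with \<open>\<mu> = \<alpha> - 1 - \<theta>\<close> and by a negative multiple of \<open>V(z\<^sub>k\<^sub>+\<^sub>1)\<close>. Once \<open>\<theta> \<mu> \<parallel>x\<^sub>k\<parallel>\<^sup>2\<close> is added to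
  its squared norm, the only contribution to the increment without a sign is the inner product of
  \<open>z\<^sub>k\<^sub>+\<^sub>1 - z\<^sub>k\<close> with \<open>V(z\<^sub>k\<^sub>+\<^sub>1)\<close>. Exchanging half of \<open>\<parallel>r\<^sub>k + q\<^sub>k\<parallel>\<^sup>2\<close> for half of \<open>\<parallel>r\<^sub>k\<parallel>\<^sup>2\<close>, which leads to \<open>G\<^sub>\<theta>\<close>,
  cancels that contribution up to a multiple of \<open>\<mu>\<close> and lower order terms.
  If the growth condition holds with margin \<open>\<epsilon>\<close> and \<open>\<mu>\<close> is small and positive compared to \<open>\<epsilon>\<close>, then
  \<open>G\<^sub>\<theta>\<close> eventually decreases by at least a fixed multiple of
  \<open>(\<parallel>r\<^sub>k\<parallel>\<^sup>2 + \<parallel>q\<^sub>k\<parallel>\<^sup>2) / k\<close> (\<open>ogda_energy_descent\<close>), and \<open>G\<^sub>\<theta>\<close> dominates a positive multiple of \<open>\<parallel>x\<^sub>k\<parallel>\<^sup>2\<close>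
  (\<open>ogda_energy_lower_bound\<close>). Hence \<open>G\<^sub>\<theta>\<close> converges, \<open>x\<^sub>k\<close> is bounded and \<open>H\<^sub>k / k\<close> is summable.

  The energy is affine in \<open>\<theta>\<close> with constant term \<open>H\<^sub>k\<close>. Since it converges for two different values of \<open>\<theta>\<close>,
  \<open>H\<^sub>k\<close> itself converges. As the harmonic series diverges, its limit can only be \<open>0\<close>
  (\<open>convergent_imp_null_if_summable_over_index\<close>), which is the claim that \<open>r\<^sub>k\<close> and \<open>q\<^sub>k\<close> vanish. The
  growth condition also makes \<open>\<beta>\<^sub>k\<close> and \<open>\<beta>\<^sub>k\<^sub>-\<^sub>1\<close> comparable, and the gap
  \<open>\<langle>x\<^sub>k, V(z\<^sub>k)\<rangle>\<close> is controlled by the norm of \<open>V(z\<^sub>k)\<close> because \<open>x\<^sub>k\<close> is bounded.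
\<close>

section \<open>Two facts on real sequences\<close>

lemma summable_of_lyapunov_decrease:
  fixes G D :: "nat \<Rightarrow> real"
  assumes step: "\<And>n. n \<ge> N \<Longrightarrow> G (Suc n) + D (Suc n) \<le> G n"
    and G_nonneg: "\<And>n. n \<ge> N \<Longrightarrow> 0 \<le> G n"
    and D_nonneg: "\<And>n. 0 \<le> D n"
  shows "convergent G" and "summable D"
proof -
  have dec: "G (Suc n + N) \<le> G (n + N)" for n
    using step[of "n + N"] D_nonneg[of "Suc (n + N)"] by simp
  hence "decseq (\<lambda>n. G (n + N))"
    by (simp add: decseq_Suc_iff)
  moreover have "\<forall>n. 0 \<le> G (n + N)"
    using G_nonneg by simp
  ultimately have "convergent (\<lambda>n. G (n + N))"
    using decseq_convergent[of "\<lambda>n. G (n + N)" 0] unfolding convergent_def by blast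
  thus "convergent G"
    by (simp add: convergent_ignore_initial_segment)
  have "(\<Sum>i<n. D (i + Suc N)) \<le> G N" for n
  proof -
    have "(\<Sum>i<n. D (i + Suc N)) \<le> G N - G (n + N)"
    proof (induction n)
      case (Suc n)
      then show ?case using step[of "n + N"] by simp
    qed simp
    thus ?thesis using G_nonneg[of "n + N"] by simp
  qed
  hence "summable (\<lambda>i. D (i + Suc N))"
    using D_nonneg by (intro summableI_nonneg_bounded) auto
  thus "summable D"
    by (rule summable_iff_shift[THEN iffD1])
qed

text \<open>A positive limit would make \<open>H n / n\<close> comparable to the harmonic series.\<close>

lemma convergent_imp_null_if_summable_over_index:
  fixes H :: "nat \<Rightarrow> real"
  assumes "convergent H" and nonneg: "\<And>n. 0 \<le> H n"
    and summ: "summable (\<lambda>n. H n / real n)"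
  shows "H \<longlonglongrightarrow> 0"
proof -
  obtain L where L: "H \<longlonglongrightarrow> L"
    using assms(1) by (auto simp: convergent_def)
  have "0 \<le> L"
    using L nonneg by (intro LIMSEQ_le_const[of H L 0]) auto
  moreover have "\<not> L > 0"
  proof
    assume "L > 0"
    hence "\<forall>\<^sub>F n in sequentially. H n > L / 2"
      using L by (intro order_tendstoD(1)) auto
    hence "\<forall>\<^sub>F n in sequentially. norm (inverse (real n)) \<le> (2 / L) * (H n / real n)"
      using eventually_gt_at_top[of 0]
      by eventually_elim (use \<open>L > 0\<close> in \<open>simp add: field_simps\<close>)
    moreover have "summable (\<lambda>n. (2 / L) * (H n / real n))"
      using summ by (rule summable_mult)
    ultimately have "summable (\<lambda>n. inverse (real n))"
      by (rule summable_comparison_test_ev)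
    thus False
      using not_summable_harmonic[where 'a = real] by (simp add: inverse_eq_divide)
  qed
  ultimately show ?thesis using L by (cases "L = 0") auto
qed

section \<open>The energy\<close>

text \<open>To be read with \<open>x\<close> the distance vector to a zero, \<open>r\<close> the velocity and \<open>q\<close> the operator value, the
  last two scaled by the index as in the introduction. Completing squares shows that it is
  \<open>\<parallel>\<theta> x + r + q / 2\<parallel>\<^sup>2 + \<theta> (\<alpha> - 1 - \<theta>) \<parallel>x\<parallel>\<^sup>2 + \<theta> \<langle>x, q\<rangle> + \<parallel>q\<parallel>\<^sup>2 / 4\<close>. The expanded form displays that it is
  affine in \<open>\<theta>\<close>, which is how the convergence of the last summand is obtained.\<close>

definition ogda_energy :: "real \<Rightarrow> real \<Rightarrow> 'a::real_inner \<Rightarrow> 'a \<Rightarrow> 'a \<Rightarrow> real" where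
  "ogda_energy \<alpha> \<theta> x r q = \<theta> * (\<alpha> - 1) * (norm x)\<^sup>2 + 2 * \<theta> * inner x (r + q)
     + ((norm (r + q))\<^sup>2 + (norm r)\<^sup>2) / 2"

lemma ogda_energy_lower_bound:
  assumes "\<theta> \<ge> 0" and "inner x q \<ge> 0"
  shows "\<theta> * (\<alpha> - 1 - \<theta>) * (norm x)\<^sup>2 \<le> ogda_energy \<alpha> \<theta> x r q"
proof -
  have "ogda_energy \<alpha> \<theta> x r q = (norm (\<theta> *\<^sub>R x + r + (1/2) *\<^sub>R q))\<^sup>2
      + \<theta> * (\<alpha> - 1 - \<theta>) * (norm x)\<^sup>2 + \<theta> * inner x q + (norm q)\<^sup>2 / 4"
    unfolding ogda_energy_def power2_norm_eq_inner
    by (simp add: inner_simps inner_commute field_simps)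
  thus ?thesis using assms by simp
qed

text \<open>The exact energy loss of one step from index \<open>n - 1\<close> to \<open>n\<close>: \<open>x\<close> is taken at the new point, \<open>d\<close> is
  the step \<open>z\<^sub>n - z\<^sub>n\<^sub>-\<^sub>1\<close>, \<open>v\<close> is \<open>V(z\<^sub>n)\<close>, \<open>e\<close> is the increment of \<open>V\<close>, and
  \<open>b = \<beta>\<^sub>n\<^sub>-\<^sub>1\<close>, \<open>h = (n - 1) (\<beta>\<^sub>n\<^sub>-\<^sub>1 - \<beta>\<^sub>n\<^sub>-\<^sub>2)\<close>. The old \<open>r'\<close> and \<open>q'\<close> are expressed through the new quantities,
  which turns the implicit scheme into a polynomial identity. In the coefficient of \<open>\<langle>d, v\<rangle>\<close> the terms of order \<open>n\<^sup>2\<close> cancel, and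
  those of order \<open>n\<close> carry the factor \<open>\<mu>\<close>, so that a small \<open>\<mu>\<close> makes the mixed
  term harmless. The square containing \<open>e\<close> absorbs the product \<open>\<langle>v, e\<rangle>\<close> at the bounded price
  \<open>m\<^sup>2 / 8\<close>.\<close>

lemma ogda_energy_balance:
  fixes x d v e :: "'a::real_inner" and \<alpha> \<mu> s b h n :: real
  defines "\<theta> \<equiv> \<alpha> - 1 - \<mu>" and "w \<equiv> (\<alpha> - 2) * b - h" and "m \<equiv> \<alpha> * b + h"
    and "P \<equiv> (n - 1) * b - h"
  assumes r': "r' = (n - 1 + \<alpha>) *\<^sub>R d + (s * m / 2) *\<^sub>R v + (s * P) *\<^sub>R e"
    and q': "q' = (s * P) *\<^sub>R (v - e)"
  shows "ogda_energy \<alpha> \<theta> (x - d) r' q' - ogda_energy \<alpha> \<theta> x (n *\<^sub>R d) ((s * n * b) *\<^sub>R v)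
    = \<theta> * \<mu> * (norm d)\<^sup>2 + (norm (\<mu> *\<^sub>R d + (s * w / 2) *\<^sub>R v))\<^sup>2 + \<theta> * s * w * inner x v
      + s * P * (n - 1 + \<alpha>) * inner d e + s\<^sup>2 / 2 * (norm (P *\<^sub>R e + (m / 2) *\<^sub>R v))\<^sup>2
      + 2 * \<mu> * n * (norm d)\<^sup>2 + s * (2 * \<mu> * n * b + (\<alpha> - 1) * (b + h)) * inner d v
      + s\<^sup>2 * (n * b * w - b * ((n - 1) * w - \<alpha> * h - b) / 2 - m\<^sup>2 / 8) * (norm v)\<^sup>2"
proof -
  \<comment> \<open>The names keep the coefficients opaque while the energies are expanded in the inner products of \<open>x\<close>, \<open>d\<close>,
    \<open>v\<close>, \<open>e\<close>; afterwards each coefficient is a separate scalar identity.\<close>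
  define A where "A = n - 1 + \<alpha>"
  define B where "B = s * n * b + s * w / 2"
  define M where "M = s * m / 2"
  define Q where "Q = s * P"
  have "M + Q = B"
    by (simp add: M_def Q_def B_def m_def w_def P_def field_simps)
  hence y': "r' + q' = A *\<^sub>R d + B *\<^sub>R v"
    unfolding r' q' by (simp add: A_def M_def Q_def scaleR_diff_right flip: scaleR_add_left)
  have r'': "r' = A *\<^sub>R d + M *\<^sub>R v + Q *\<^sub>R e"
    by (simp add: r' A_def M_def Q_def)
  have "ogda_energy \<alpha> \<theta> (x - d) r' q' - ogda_energy \<alpha> \<theta> x (n *\<^sub>R d) ((s * n * b) *\<^sub>R v)
      = 2 * \<theta> * (A - n - (\<alpha> - 1)) * inner x d + 2 * \<theta> * (B - s * n * b) * inner x v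
        + (\<theta> * (\<alpha> - 1) - 2 * \<theta> * A + A\<^sup>2 - n\<^sup>2) * inner d d
        + (A * B + A * M - n * (s * n * b) - 2 * \<theta> * B) * inner d v
        + (B\<^sup>2 + M\<^sup>2 - (s * n * b)\<^sup>2) / 2 * inner v v
        + Q\<^sup>2 / 2 * inner e e + A * Q * inner d e + M * Q * inner v e"
    unfolding ogda_energy_def y' unfolding r'' power2_norm_eq_inner
    by (simp add: inner_simps inner_commute[of d x] inner_commute[of v x] inner_commute[of v d]
      inner_commute[of e d] inner_commute[of e v] power2_eq_square field_simps)
  also have "A - n - (\<alpha> - 1) = 0"
    by (simp add: A_def)
  also have "2 * \<theta> * (B - s * n * b) = \<theta> * s * w"
    by (simp add: B_def)
  also have "\<theta> * (\<alpha> - 1) - 2 * \<theta> * A + A\<^sup>2 - n\<^sup>2 = \<theta> * \<mu> + \<mu>\<^sup>2 + 2 * \<mu> * n"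
    unfolding A_def \<theta>_def by (simp add: power2_eq_square algebra_simps)
  also have "A * B + A * M - n * (s * n * b) - 2 * \<theta> * B
      = \<mu> * s * w + s * (2 * \<mu> * n * b + (\<alpha> - 1) * (b + h))"
    unfolding A_def B_def M_def \<theta>_def w_def m_def by (simp add: field_simps)
  also have "(B\<^sup>2 + M\<^sup>2 - (s * n * b)\<^sup>2) / 2 = (s * w / 2)\<^sup>2 + s\<^sup>2 / 2 * (m / 2)\<^sup>2
      + s\<^sup>2 * (n * b * w - b * ((n - 1) * w - \<alpha> * h - b) / 2 - m\<^sup>2 / 8)"
    unfolding B_def M_def w_def m_def by (simp add: power2_eq_square field_simps)
  also have "2 * \<theta> * 0 * inner x d + \<theta> * s * w * inner x v
        + (\<theta> * \<mu> + \<mu>\<^sup>2 + 2 * \<mu> * n) * inner d d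
        + (\<mu> * s * w + s * (2 * \<mu> * n * b + (\<alpha> - 1) * (b + h))) * inner d v
        + ((s * w / 2)\<^sup>2 + s\<^sup>2 / 2 * (m / 2)\<^sup>2
          + s\<^sup>2 * (n * b * w - b * ((n - 1) * w - \<alpha> * h - b) / 2 - m\<^sup>2 / 8)) * inner v v
        + Q\<^sup>2 / 2 * inner e e + A * Q * inner d e + M * Q * inner v e
    = \<theta> * \<mu> * (norm d)\<^sup>2 + (norm (\<mu> *\<^sub>R d + (s * w / 2) *\<^sub>R v))\<^sup>2 + \<theta> * s * w * inner x v
      + s * P * (n - 1 + \<alpha>) * inner d e + s\<^sup>2 / 2 * (norm (P *\<^sub>R e + (m / 2) *\<^sub>R v))\<^sup>2
      + 2 * \<mu> * n * (norm d)\<^sup>2 + s * (2 * \<mu> * n * b + (\<alpha> - 1) * (b + h)) * inner d v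
      + s\<^sup>2 * (n * b * w - b * ((n - 1) * w - \<alpha> * h - b) / 2 - m\<^sup>2 / 8) * (norm v)\<^sup>2"
  proof -
    define R where "R = s\<^sup>2 * (n * b * w - b * ((n - 1) * w - \<alpha> * h - b) / 2 - m\<^sup>2 / 8)"
    define T where "T = s * (2 * \<mu> * n * b + (\<alpha> - 1) * (b + h))"
    show ?thesis
      unfolding R_def[symmetric] T_def[symmetric] power2_norm_eq_inner
      by (simp add: inner_simps inner_commute[of v d] inner_commute[of e v] A_def M_def Q_def
        power2_eq_square field_simps)
  qed
  finally show ?thesis .
qed

text \<open>In the balance, the two terms with \<open>\<langle>x, v\<rangle>\<close> and \<open>\<langle>d, e\<rangle>\<close> are nonnegative by monotonicity. Up to
  contributions that do not grow with \<open>n\<close>, what remains is at least \<open>n\<close> times the quadratic form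
  \<open>2 \<mu> \<parallel>d\<parallel>\<^sup>2 + 2 \<mu> \<langle>d, s b v\<rangle> + \<epsilon> / 2 \<parallel>s b v\<parallel>\<^sup>2\<close>, which is positive definite when \<open>0 < \<mu> < \<epsilon>\<close>.
  Bounding the mixed term by \<open>\<mu> (\<parallel>d\<parallel>\<^sup>2 + \<parallel>s b v\<parallel>\<^sup>2)\<close> costs a factor two in the range of \<open>\<mu>\<close>;
  with \<open>\<mu>\<close> between \<open>\<epsilon> / 8\<close> and \<open>\<epsilon> / 4\<close> both diagonal coefficients are still at least \<open>\<epsilon> / 8\<close>, and the largeness of \<open>n\<close> leaves half of that after
  paying for the bounded contributions.\<close>

lemma ogda_energy_descent:
  fixes x d v e :: "'a::real_inner" and \<alpha> \<mu> \<epsilon> s b h n :: real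
  assumes "\<epsilon> > 0" and "\<epsilon> \<le> \<alpha> - 2" and \<mu>: "\<epsilon> / 8 \<le> \<mu>" "\<mu> \<le> \<epsilon> / 4"
    and "s > 0" and "b > 0" and h: "0 \<le> h" "h \<le> (\<alpha> - 2 - \<epsilon>) * b" "h \<le> (n - 1) * b"
    and n: "n \<ge> 1" "n \<ge> 16 * (\<alpha> - 1)\<^sup>2 / \<epsilon>"
    and mono_xv: "inner x v \<ge> 0" and mono_de: "inner d e \<ge> 0"
    and r': "r' = (n - 1 + \<alpha>) *\<^sub>R d + (s * (\<alpha> * b + h) / 2) *\<^sub>R v + (s * ((n - 1) * b - h)) *\<^sub>R e"
    and q': "q' = (s * ((n - 1) * b - h)) *\<^sub>R (v - e)"
  shows "ogda_energy \<alpha> (\<alpha> - 1 - \<mu>) x (n *\<^sub>R d) ((s * n * b) *\<^sub>R v)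
      + \<epsilon> / 16 * (n * ((norm d)\<^sup>2 + (s * b * norm v)\<^sup>2))
    \<le> ogda_energy \<alpha> (\<alpha> - 1 - \<mu>) (x - d) r' q'"
proof -
  define w where "w = (\<alpha> - 2) * b - h"
  define m where "m = \<alpha> * b + h"
  define K where "K = (\<alpha> - 1)\<^sup>2"
  define X where "X = (norm d)\<^sup>2"
  define Y where "Y = (s * b * norm v)\<^sup>2"
  have w: "\<epsilon> * b \<le> w"
    using h by (simp add: w_def algebra_simps)
  have w_nonneg: "0 \<le> w"
    using w \<open>\<epsilon> > 0\<close> \<open>b > 0\<close> by (meson less_le_trans mult_pos_pos less_imp_le)
  have h_le: "h \<le> (\<alpha> - 2) * b"
    using w_nonneg by (simp add: w_def)
  have "K \<ge> 0" "X \<ge> 0" "Y \<ge> 0"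
    by (simp_all add: K_def X_def Y_def)
  have K: "K \<le> \<epsilon> * n / 16"
    using n(2) \<open>\<epsilon> > 0\<close> by (simp add: K_def field_simps)

  \<comment> \<open>\<open>K\<close> collects what does not grow with \<open>n\<close>: since \<open>h \<le> (\<alpha> - 2) b\<close>, it bounds \<open>(\<alpha> - 1) (b + h) / b\<close>.\<close>
  have cross: "s * (2 * \<mu> * n * b + (\<alpha> - 1) * (b + h)) * inner d v
      \<ge> - ((2 * \<mu> * n + K) * ((X + Y) / 2))"
  proof -
    have "(\<alpha> - 1) * (b + h) \<le> (\<alpha> - 1) * ((\<alpha> - 1) * b)"
      using h_le assms(1,2) by (intro mult_left_mono) (auto simp: algebra_simps)
    hence "2 * \<mu> * n * b + (\<alpha> - 1) * (b + h) \<le> (2 * \<mu> * n + K) * b"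
      by (simp add: K_def algebra_simps power2_eq_square)
    moreover have "0 \<le> 2 * \<mu> * n * b + (\<alpha> - 1) * (b + h)"
      using assms(1-3) h(1) n(1) \<open>b > 0\<close> by (intro add_nonneg_nonneg mult_nonneg_nonneg) auto
    ultimately have "(2 * \<mu> * n * b + (\<alpha> - 1) * (b + h)) * \<bar>inner d v\<bar>
        \<le> ((2 * \<mu> * n + K) * b) * (norm d * norm v)"
      using Cauchy_Schwarz_ineq2[of d v] by (intro mult_mono) auto
    hence "s * ((2 * \<mu> * n * b + (\<alpha> - 1) * (b + h)) * \<bar>inner d v\<bar>)
        \<le> s * (((2 * \<mu> * n + K) * b) * (norm d * norm v))"
      using \<open>s > 0\<close> by (intro mult_left_mono) auto
    also have "\<dots> = (2 * \<mu> * n + K) * (norm d * (s * b * norm v))"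
      by (simp add: mult_ac)
    also have "\<dots> \<le> (2 * \<mu> * n + K) * ((X + Y) / 2)"
      using sum_squares_bound[of "norm d" "s * b * norm v"] assms(1,3) n(1) \<open>K \<ge> 0\<close>
      by (intro mult_left_mono) (auto simp: X_def Y_def)
    finally have "\<bar>s * (2 * \<mu> * n * b + (\<alpha> - 1) * (b + h)) * inner d v\<bar>
        \<le> (2 * \<mu> * n + K) * ((X + Y) / 2)"
      using \<open>0 \<le> 2 * \<mu> * n * b + (\<alpha> - 1) * (b + h)\<close> \<open>s > 0\<close> by (simp add: abs_mult mult.assoc)
    thus ?thesis by linarith
  qed

  \<comment> \<open>Half of \<open>n b w\<close> survives the subtraction, and it is at least \<open>n \<epsilon> b\<^sup>2 / 2\<close> by the growth margin.\<close>
  have op_coeff: "(n * \<epsilon> / 2 - K / 2) * b\<^sup>2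
      \<le> n * b * w - b * ((n - 1) * w - \<alpha> * h - b) / 2 - m\<^sup>2 / 8"
  proof -
    have "m \<le> 2 * (\<alpha> - 1) * b"
      using h_le by (simp add: m_def algebra_simps)
    moreover have "0 \<le> m"
      using assms(1,2) \<open>b > 0\<close> h(1) by (simp add: m_def)
    ultimately have "m\<^sup>2 \<le> (2 * (\<alpha> - 1) * b)\<^sup>2"
      by (intro power_mono)
    hence m: "m\<^sup>2 / 8 \<le> K / 2 * b\<^sup>2"
      unfolding power_mult_distrib K_def by simp
    have "(n * b) * (\<epsilon> * b) \<le> (n * b) * w"
      using w n(1) \<open>b > 0\<close> by (intro mult_left_mono) auto
    hence "n * \<epsilon> / 2 * b\<^sup>2 \<le> n * b * w / 2"
      by (simp add: power2_eq_square algebra_simps)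
    moreover have "0 \<le> b * w" "0 \<le> b * (\<alpha> * h)" "0 \<le> b * b"
      using w_nonneg \<open>b > 0\<close> h(1) assms(1,2) by auto
    moreover have "n * b * w - b * ((n - 1) * w - \<alpha> * h - b) / 2
        = n * b * w / 2 + b * w / 2 + b * (\<alpha> * h) / 2 + b * b / 2"
      by (simp add: field_simps)
    moreover have "(n * \<epsilon> / 2 - K / 2) * b\<^sup>2 = n * \<epsilon> / 2 * b\<^sup>2 - K / 2 * b\<^sup>2"
      by (rule left_diff_distrib)
    ultimately show ?thesis
      using m by linarith
  qed
  have op: "(n * \<epsilon> / 2 - K / 2) * Y
      \<le> s\<^sup>2 * (n * b * w - b * ((n - 1) * w - \<alpha> * h - b) / 2 - m\<^sup>2 / 8) * (norm v)\<^sup>2"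
  proof -
    have "(n * \<epsilon> / 2 - K / 2) * Y = s\<^sup>2 * ((n * \<epsilon> / 2 - K / 2) * b\<^sup>2) * (norm v)\<^sup>2"
      by (simp add: Y_def power_mult_distrib)
    also have "\<dots> \<le> s\<^sup>2 * (n * b * w - b * ((n - 1) * w - \<alpha> * h - b) / 2 - m\<^sup>2 / 8) * (norm v)\<^sup>2"
      using op_coeff by (intro mult_right_mono mult_left_mono) auto
    finally show ?thesis .
  qed

  have "\<epsilon> / 16 * n * X \<le> (\<mu> * n - K / 2) * X"
  proof (intro mult_right_mono)
    have "\<epsilon> / 8 * n \<le> \<mu> * n" using \<mu>(1) n(1) by (intro mult_right_mono) auto
    thus "\<epsilon> / 16 * n \<le> \<mu> * n - K / 2" using K \<open>K \<ge> 0\<close> by linarith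
  qed fact
  moreover have "\<epsilon> / 16 * n * Y \<le> (n * \<epsilon> / 2 - K - \<mu> * n) * Y"
  proof (intro mult_right_mono)
    have "\<mu> * n \<le> \<epsilon> / 4 * n" using \<mu>(2) n(1) by (intro mult_right_mono) auto
    moreover have "0 \<le> \<epsilon> * n" using \<open>\<epsilon> > 0\<close> n(1) by simp
    ultimately show "\<epsilon> / 16 * n \<le> n * \<epsilon> / 2 - K - \<mu> * n" using K
      by (simp add: mult.commute)
  qed fact
  ultimately have main: "\<epsilon> / 16 * (n * (X + Y))
      \<le> 2 * \<mu> * n * X - (2 * \<mu> * n + K) * ((X + Y) / 2) + (n * \<epsilon> / 2 - K / 2) * Y"
    by (simp add: algebra_simps add_divide_distrib)

  have "0 \<le> (\<alpha> - 1 - \<mu>) * \<mu> * X" "0 \<le> (\<alpha> - 1 - \<mu>) * s * w * inner x v"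
      "0 \<le> s * ((n - 1) * b - h) * (n - 1 + \<alpha>) * inner d e"
    using assms(1-6) h(3) n(1) w_nonneg mono_xv mono_de \<open>X \<ge> 0\<close>
    by (auto intro!: mult_nonneg_nonneg)
  moreover have "0 \<le> (norm (\<mu> *\<^sub>R d + (s * w / 2) *\<^sub>R v))\<^sup>2"
      "0 \<le> s\<^sup>2 / 2 * (norm (((n - 1) * b - h) *\<^sub>R e + (m / 2) *\<^sub>R v))\<^sup>2"
    by simp_all
  moreover note ogda_energy_balance[OF r' q', where x = x and \<mu> = \<mu>,
      folded w_def m_def X_def]
  ultimately show ?thesis
    using cross op main unfolding X_def Y_def by linarith
qed

section \<open>Decay along the iterates\<close>

lemma growth_condition_margin:
  assumes "growth_condition \<alpha> \<beta>" and pos: "\<And>k. \<beta> k > 0"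
  obtains \<epsilon> where "\<epsilon> > 0" and "\<epsilon> \<le> \<alpha> - 2"
    and "\<And>k. k \<ge> 1 \<Longrightarrow> real k * (\<beta> k - \<beta> (k - 1)) \<le> (\<alpha> - 2 - \<epsilon>) * \<beta> k"
proof
  let ?S = "SUP k\<in>{1..}. real k * (\<beta> k - \<beta> (k - 1)) / \<beta> k"
  show "\<alpha> - 2 - ?S > 0" "\<alpha> - 2 - ?S \<le> \<alpha> - 2"
    using assms(1) by (auto simp: growth_condition_def)
  fix k :: nat assume "k \<ge> 1"
  hence "real k * (\<beta> k - \<beta> (k - 1)) / \<beta> k \<le> ?S"
    using assms(1) by (intro cSUP_upper) (auto simp: growth_condition_def)
  thus "real k * (\<beta> k - \<beta> (k - 1)) \<le> (\<alpha> - 2 - (\<alpha> - 2 - ?S)) * \<beta> k"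
    using pos[of k] by (simp add: divide_le_eq)
qed

text \<open>Solving the scheme for the previous velocity makes it explicit: the new step, the new operator value and its increment
  determine the old momentum, which is the form in which the energy identity consumes it.\<close>

lemma implicit_fast_OGDA_momentum:
  assumes "implicit_fast_OGDA V \<alpha> s \<beta> z" and "\<alpha> > 0" and "k \<ge> 1"
  shows "real k *\<^sub>R (z k - z (k - 1)) = (real k + \<alpha>) *\<^sub>R (z (k + 1) - z k)
    + (s * (\<alpha> * \<beta> k + real k * (\<beta> k - \<beta> (k - 1))) / 2) *\<^sub>R V (z (k + 1))
    + (s * (real k * \<beta> (k - 1))) *\<^sub>R (V (z (k + 1)) - V (z k))"
proof -
  let ?c = "real k + \<alpha>"
  have c: "?c > 0" using assms(2) by (simp add: add_nonneg_pos)
  have "z (k + 1) - z k = (1 - \<alpha> / ?c) *\<^sub>R (z k - z (k - 1))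
      - (s * (\<alpha> * \<beta> k + real k * (\<beta> k - \<beta> (k - 1))) / (2 * ?c)) *\<^sub>R V (z (k + 1))
      - (s * real k * \<beta> (k - 1) / ?c) *\<^sub>R (V (z (k + 1)) - V (z k))" (is "_ = ?R")
    using assms(1,3) unfolding implicit_fast_OGDA_def by (simp add: algebra_simps)
  hence "?c *\<^sub>R (z (k + 1) - z k) = ?c *\<^sub>R ?R" by (rule arg_cong)
  also have "\<dots> = (?c * (1 - \<alpha> / ?c)) *\<^sub>R (z k - z (k - 1))
      - (?c * (s * (\<alpha> * \<beta> k + real k * (\<beta> k - \<beta> (k - 1))) / (2 * ?c))) *\<^sub>R V (z (k + 1))
      - (?c * (s * real k * \<beta> (k - 1) / ?c)) *\<^sub>R (V (z (k + 1)) - V (z k))"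
    by (simp only: scaleR_diff_right scaleR_scaleR)
  also have "?c * (1 - \<alpha> / ?c) = real k" using c by (simp add: field_simps)
  also have "?c * (s * (\<alpha> * \<beta> k + real k * (\<beta> k - \<beta> (k - 1))) / (2 * ?c))
      = s * (\<alpha> * \<beta> k + real k * (\<beta> k - \<beta> (k - 1))) / 2"
    using c by (simp add: field_simps)
  also have "?c * (s * real k * \<beta> (k - 1) / ?c) = s * (real k * \<beta> (k - 1))" using c by simp
  finally show ?thesis by simp
qed

lemma monotone_operator_inner_zero_nonneg:
  assumes "monotone_operator V" and "z_star \<in> zeros V"
  shows "0 \<le> inner (y - z_star) (V y)"
  using assms unfolding monotone_operator_def zeros_def
  by (metis (mono_tags) diff_zero mem_Collect_eq)

text \<open>The Lyapunov argument. The energy is used at \<open>\<mu> = \<epsilon> / 8\<close> and \<open>\<mu> = \<epsilon> / 4\<close>, the end points of the range treated in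
  \<open>ogda_energy_descent\<close>; eliminating the terms linear in \<open>\<theta>\<close> between the two isolates
  \<open>H\<close>. The weight on \<open>V(z\<^sub>n)\<close> is \<open>\<beta>\<^sub>n\<^sub>-\<^sub>1\<close> here, since that is the one the scheme produces.\<close>

lemma implicit_fast_OGDA_null:
  fixes V :: "'a::real_inner \<Rightarrow> 'a" and z :: "nat \<Rightarrow> 'a"
  assumes monotone: "monotone_operator V" and zero: "z_star \<in> zeros V"
    and "\<alpha> > 2" and "s > 0" and pos: "\<And>k. \<beta> k > 0" and "mono \<beta>"
    and growth: "growth_condition \<alpha> \<beta>" and ogda: "implicit_fast_OGDA V \<alpha> s \<beta> z"
  shows "(\<lambda>n. real n * norm (z n - z (n - 1))) \<longlonglongrightarrow> 0"
    and "(\<lambda>n. real n * \<beta> (n - 1) * norm (V (z n))) \<longlonglongrightarrow> 0"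
    and "Bseq (\<lambda>n. z n - z_star)"
proof -
  obtain \<epsilon> where \<epsilon>: "\<epsilon> > 0" "\<epsilon> \<le> \<alpha> - 2"
    and h_le: "\<And>k. k \<ge> 1 \<Longrightarrow> real k * (\<beta> k - \<beta> (k - 1)) \<le> (\<alpha> - 2 - \<epsilon>) * \<beta> k"
    using growth_condition_margin[OF growth pos] by blast
  define x where "x n = z n - z_star" for n
  define r where "r n = real n *\<^sub>R (z n - z (n - 1))" for n
  define q where "q n = (s * real n * \<beta> (n - 1)) *\<^sub>R V (z n)" for n
  define D where "D n = \<epsilon> / 16 * (real n * ((norm (z n - z (n - 1)))\<^sup>2 + (s * \<beta> (n - 1) * norm (V (z n)))\<^sup>2))"
    for n
  define E where "E \<mu> n = ogda_energy \<alpha> (\<alpha> - 1 - \<mu>) (x n) (r n) (q n)" for \<mu> n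
  define H where "H n = ((norm (r n + q n))\<^sup>2 + (norm (r n))\<^sup>2) / 2" for n
  define N where "N = max 1 (nat \<lceil>16 * (\<alpha> - 1)\<^sup>2 / \<epsilon>\<rceil>)"

  have xV: "0 \<le> inner (x n) (V (z n))" for n
    using monotone_operator_inner_zero_nonneg[OF monotone zero] by (simp add: x_def)
  have xq: "0 \<le> inner (x n) (q n)" for n
    using xV[of n] pos[of "n - 1"] \<open>s > 0\<close> by (simp add: q_def)
  have E_lower: "(\<alpha> - 1 - \<mu>) * \<mu> * (norm (x n))\<^sup>2 \<le> E \<mu> n" if "\<mu> \<le> \<epsilon> / 4" for \<mu> n
    using ogda_energy_lower_bound[of "\<alpha> - 1 - \<mu>" "x n" "q n" \<alpha> "r n"] xq[of n] \<epsilon> that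
    by (simp add: E_def)

  have step: "E \<mu> (Suc k) + D (Suc k) \<le> E \<mu> k"
    if "k \<ge> N" and \<mu>: "\<epsilon> / 8 \<le> \<mu>" "\<mu> \<le> \<epsilon> / 4" for \<mu> k
  proof -
    have k: "k \<ge> 1" "real k \<ge> 16 * (\<alpha> - 1)\<^sup>2 / \<epsilon>"
      using \<open>k \<ge> N\<close> by (auto simp: N_def nat_le_iff ceiling_le_iff)
    define h where "h = real k * (\<beta> k - \<beta> (k - 1))"
    have P: "(real (Suc k) - 1) * \<beta> k - h = real k * \<beta> (k - 1)"
      by (simp add: h_def algebra_simps)
    have x_eq: "x k = x (Suc k) - (z (Suc k) - z k)"
      by (simp add: x_def)
    have "E \<mu> k = ogda_energy \<alpha> (\<alpha> - 1 - \<mu>) (x (Suc k) - (z (Suc k) - z k)) (r k) (q k)"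
      unfolding E_def using x_eq by simp
    moreover have "E \<mu> (Suc k) = ogda_energy \<alpha> (\<alpha> - 1 - \<mu>) (x (Suc k))
        (real (Suc k) *\<^sub>R (z (Suc k) - z k)) ((s * real (Suc k) * \<beta> k) *\<^sub>R V (z (Suc k)))"
      by (simp add: E_def r_def q_def)
    moreover have "D (Suc k) = \<epsilon> / 16 * (real (Suc k) * ((norm (z (Suc k) - z k))\<^sup>2
        + (s * \<beta> k * norm (V (z (Suc k))))\<^sup>2))"
      by (simp add: D_def)
    moreover have "ogda_energy \<alpha> (\<alpha> - 1 - \<mu>) (x (Suc k))
        (real (Suc k) *\<^sub>R (z (Suc k) - z k)) ((s * real (Suc k) * \<beta> k) *\<^sub>R V (z (Suc k)))
        + \<epsilon> / 16 * (real (Suc k) * ((norm (z (Suc k) - z k))\<^sup>2 + (s * \<beta> k * norm (V (z (Suc k))))\<^sup>2))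
      \<le> ogda_energy \<alpha> (\<alpha> - 1 - \<mu>) (x (Suc k) - (z (Suc k) - z k)) (r k) (q k)"
    proof (rule ogda_energy_descent[OF \<epsilon> \<mu> \<open>s > 0\<close> pos[of k],
          where h = h and e = "V (z (Suc k)) - V (z k)"])
      show "0 \<le> h"
        using \<open>mono \<beta>\<close> by (simp add: h_def monoD)
      show "h \<le> (\<alpha> - 2 - \<epsilon>) * \<beta> k"
        using h_le[OF k(1)] by (simp add: h_def)
      show "h \<le> (real (Suc k) - 1) * \<beta> k"
        using pos[of "k - 1"] by (simp add: h_def mult_left_mono less_imp_le)
      show "1 \<le> real (Suc k)" "16 * (\<alpha> - 1)\<^sup>2 / \<epsilon> \<le> real (Suc k)"
        using k by simp_all
      show "0 \<le> inner (x (Suc k)) (V (z (Suc k)))"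
        by (rule xV)
      show "0 \<le> inner (z (Suc k) - z k) (V (z (Suc k)) - V (z k))"
        using monotone by (simp add: monotone_operator_def)
      show "r k = (real (Suc k) - 1 + \<alpha>) *\<^sub>R (z (Suc k) - z k)
          + (s * (\<alpha> * \<beta> k + h) / 2) *\<^sub>R V (z (Suc k))
          + (s * ((real (Suc k) - 1) * \<beta> k - h)) *\<^sub>R (V (z (Suc k)) - V (z k))"
        unfolding P unfolding r_def h_def
        using implicit_fast_OGDA_momentum[OF ogda _ k(1)] \<open>\<alpha> > 2\<close> by simp
      show "q k = (s * ((real (Suc k) - 1) * \<beta> k - h))
          *\<^sub>R (V (z (Suc k)) - (V (z (Suc k)) - V (z k)))"
        unfolding P by (simp add: q_def)
    qed
    ultimately show ?thesis by simp
  qed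
  have D_nonneg: "0 \<le> D n" for n
    using \<epsilon>(1) by (simp add: D_def)
  have E_nonneg: "0 \<le> E \<mu> n" if "\<epsilon> / 8 \<le> \<mu>" "\<mu> \<le> \<epsilon> / 4" for \<mu> n
  proof -
    have "0 \<le> (\<alpha> - 1 - \<mu>) * \<mu> * (norm (x n))\<^sup>2"
      using that \<epsilon> by (intro mult_nonneg_nonneg) auto
    thus ?thesis using E_lower[OF that(2), of n] by linarith
  qed
  have E_conv: "convergent (E \<mu>)" if "\<epsilon> / 8 \<le> \<mu>" "\<mu> \<le> \<epsilon> / 4" for \<mu>
    using step[OF _ that] E_nonneg[OF that] D_nonneg
    by (rule summable_of_lyapunov_decrease(1))
  have D_summable: "summable D"
    using step[of _ "\<epsilon> / 4"] E_nonneg[of "\<epsilon> / 4"] D_nonneg \<epsilon>(1)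
    by (intro summable_of_lyapunov_decrease(2)[of N "E (\<epsilon> / 4)"]) auto

  have "convergent H"
  proof -
    let ?a = "\<alpha> - 1 - \<epsilon> / 8" and ?b = "\<alpha> - 1 - \<epsilon> / 4"
    define A where "A n = (\<alpha> - 1) * (norm (x n))\<^sup>2 + 2 * inner (x n) (r n + q n)" for n
    have E_affine: "E \<mu> n = (\<alpha> - 1 - \<mu>) * A n + H n" for \<mu> n
      unfolding E_def ogda_energy_def A_def H_def by (simp only: distrib_left mult_ac)
    have eliminate: "a * (b * A n + H n) - b * (a * A n + H n) = (a - b) * H n" for a b n
      by (simp only: distrib_left left_diff_distrib mult_ac add_diff_add diff_self add_0_left
          right_diff_distrib)
    have "H = (\<lambda>n. (8 / \<epsilon>) * (?a * E (\<epsilon> / 4) n - ?b * E (\<epsilon> / 8) n))"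
    proof
      fix n
      have "?a * E (\<epsilon> / 4) n - ?b * E (\<epsilon> / 8) n = (?a - ?b) * H n"
        unfolding E_affine by (rule eliminate)
      thus "H n = (8 / \<epsilon>) * (?a * E (\<epsilon> / 4) n - ?b * E (\<epsilon> / 8) n)"
        using \<epsilon>(1) by (simp add: field_simps)
    qed
    moreover have "convergent (\<lambda>n. (8 / \<epsilon>) * (?a * E (\<epsilon> / 4) n - ?b * E (\<epsilon> / 8) n))"
      using \<epsilon>(1) by (intro convergent_mult convergent_diff convergent_const E_conv) auto
    ultimately show ?thesis by simp
  qed
  moreover have H_nonneg: "0 \<le> H n" for n
    by (simp add: H_def)
  moreover have "summable (\<lambda>n. H n / real n)"
  proof (rule summable_comparison_test)
    show "summable (\<lambda>n. 24 / \<epsilon> * D n)"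
      using D_summable by (rule summable_mult)
    have "norm (H n / real n) \<le> 24 / \<epsilon> * D n" for n
    proof (cases "n = 0")
      case True
      thus ?thesis using D_nonneg \<epsilon>(1) by simp
    next
      case False
      have norm_r: "norm (r n) = real n * norm (z n - z (n - 1))"
        and norm_q: "norm (q n) = s * real n * \<beta> (n - 1) * norm (V (z n))"
        using \<open>s > 0\<close> pos[of "n - 1"] by (simp_all add: r_def q_def abs_mult)
      have sum_sq: "(norm (r n + q n))\<^sup>2 \<le> 2 * (norm (r n))\<^sup>2 + 2 * (norm (q n))\<^sup>2"
      proof -
        have "(norm (r n + q n))\<^sup>2 \<le> (norm (r n) + norm (q n))\<^sup>2"
          by (intro power_mono norm_triangle_ineq) simp
        also have "\<dots> \<le> 2 * (norm (r n))\<^sup>2 + 2 * (norm (q n))\<^sup>2"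
          using sum_squares_bound[of "norm (r n)" "norm (q n)"] by (simp add: power2_sum)
        finally show ?thesis .
      qed
      have halve: "(c + a) / 2 \<le> 3 / 2 * (a + b)" if "c \<le> 2 * a + 2 * b" "0 \<le> b" for a b c :: real
        using that by (simp add: field_simps)
      have "H n \<le> 3 / 2 * ((norm (r n))\<^sup>2 + (norm (q n))\<^sup>2)"
        unfolding H_def using sum_sq by (rule halve) simp
      also have "\<dots> = real n * (24 / \<epsilon> * D n)"
        unfolding norm_r norm_q D_def using \<epsilon>(1)
        by (simp add: field_simps power2_eq_square)
      finally show ?thesis
        using False H_nonneg[of n] by (simp add: field_simps)
    qed
    thus "\<exists>M. \<forall>n\<ge>M. norm (H n / real n) \<le> 24 / \<epsilon> * D n" by blast
  qed
  ultimately have H_null: "H \<longlonglongrightarrow> 0"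
    by (rule convergent_imp_null_if_summable_over_index)

  have r_null: "(\<lambda>n. norm (r n)) \<longlonglongrightarrow> 0" and y_null: "(\<lambda>n. norm (r n + q n)) \<longlonglongrightarrow> 0"
  proof -
    have bound: "norm (r n) \<le> sqrt (2 * H n)" "norm (r n + q n) \<le> sqrt (2 * H n)" for n
      by (auto intro!: real_le_rsqrt simp: H_def)
    have sqrt_null: "(\<lambda>n. sqrt (2 * H n)) \<longlonglongrightarrow> 0"
      using tendsto_real_sqrt[OF tendsto_mult_right_zero[OF H_null, of 2]] by simp
    show "(\<lambda>n. norm (r n)) \<longlonglongrightarrow> 0"
      by (rule tendsto_sandwich[OF _ _ tendsto_const sqrt_null]) (auto simp: bound)
    show "(\<lambda>n. norm (r n + q n)) \<longlonglongrightarrow> 0"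
      by (rule tendsto_sandwich[OF _ _ tendsto_const sqrt_null]) (auto simp: bound)
  qed
  show "(\<lambda>n. real n * norm (z n - z (n - 1))) \<longlonglongrightarrow> 0"
    using r_null by (simp add: r_def)
  have "(\<lambda>n. (r n + q n) - r n) \<longlonglongrightarrow> 0 - 0"
    using r_null y_null by (intro tendsto_diff) (auto simp: tendsto_norm_zero_iff)
  hence "(\<lambda>n. norm (q n)) \<longlonglongrightarrow> 0"
    by (simp add: tendsto_norm_zero_iff)
  hence "(\<lambda>n. (1 / s) * norm (q n)) \<longlonglongrightarrow> 0"
    by (rule tendsto_mult_right_zero)
  moreover have "(1 / s) * norm (q n) = real n * \<beta> (n - 1) * norm (V (z n))" for n
    using \<open>s > 0\<close> pos[of "n - 1"] by (simp add: q_def abs_mult)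
  ultimately show "(\<lambda>n. real n * \<beta> (n - 1) * norm (V (z n))) \<longlonglongrightarrow> 0"
    by simp

  show "Bseq (\<lambda>n. z n - z_star)"
  proof -
    let ?c = "(\<alpha> - 1 - \<epsilon> / 4) * (\<epsilon> / 4)"
    have c: "?c > 0" using \<epsilon> by (intro mult_pos_pos) auto
    have "Bseq (E (\<epsilon> / 4))"
      using E_conv[of "\<epsilon> / 4"] \<epsilon>(1) by (intro convergent_imp_Bseq) auto
    then obtain B where B: "\<And>n. norm (E (\<epsilon> / 4) n) \<le> B"
      unfolding Bseq_def by blast
    have "norm (x n) \<le> sqrt (B / ?c)" for n
    proof (rule real_le_rsqrt)
      have "?c * (norm (x n))\<^sup>2 \<le> B"
        using E_lower[of "\<epsilon> / 4" n] B[of n] by simp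
      thus "(norm (x n))\<^sup>2 \<le> B / ?c"
        using c by (simp add: pos_le_divide_eq mult.commute)
    qed
    thus ?thesis
      unfolding x_def by (rule BseqI')
  qed
qed

theorem theorem12:
  fixes V :: "'a::{real_inner, complete_space} \<Rightarrow> 'a"
    and \<alpha> s :: real
    and \<beta> :: "nat \<Rightarrow> real"
    and z :: "nat \<Rightarrow> 'a"
    and z_star :: 'a
  assumes "monotone_operator V"
    and "continuous_on UNIV V"
    and "z_star \<in> zeros V"
    and "\<alpha> > 2"
    and "s > 0"
    and "\<And>k. \<beta> k > 0"
    and "mono \<beta>"
    and "growth_condition \<alpha> \<beta>"
    and "implicit_fast_OGDA V \<alpha> s \<beta> z"
  shows "(\<lambda>k. norm (z k - z (k - 1))) \<in> o(\<lambda>k. 1 / real k)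
    \<and> (\<lambda>k. inner (z k - z_star) (V (z k))) \<in> o(\<lambda>k. 1 / (real k * \<beta> k))
    \<and> (\<lambda>k. norm (V (z k))) \<in> o(\<lambda>k. 1 / (real k * \<beta> k))"
proof -
  note null = implicit_fast_OGDA_null[OF assms(1,3-9)]
  note pos = assms(6)
  \<comment> \<open>The growth condition gives \<open>\<beta>\<^sub>k \<le> 2 \<beta>\<^sub>k\<^sub>-\<^sub>1\<close> for large \<open>k\<close>, so the index of the weight may be shifted.\<close>
  have V_null: "(\<lambda>k. real k * \<beta> k * norm (V (z k))) \<longlonglongrightarrow> 0"
  proof (rule tendsto_sandwich[OF _ _ tendsto_const])
    show "(\<lambda>k. 2 * (real k * \<beta> (k - 1) * norm (V (z k)))) \<longlonglongrightarrow> 0"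
      using null(2) by (rule tendsto_mult_right_zero)
    show "\<forall>\<^sub>F k in sequentially. 0 \<le> real k * \<beta> k * norm (V (z k))"
      using pos by (simp add: less_imp_le)
    show "\<forall>\<^sub>F k in sequentially. real k * \<beta> k * norm (V (z k))
        \<le> 2 * (real k * \<beta> (k - 1) * norm (V (z k)))"
    proof -
      obtain \<epsilon> where \<epsilon>: "\<epsilon> > 0"
        and growth: "\<And>k. k \<ge> 1 \<Longrightarrow> real k * (\<beta> k - \<beta> (k - 1)) \<le> (\<alpha> - 2 - \<epsilon>) * \<beta> k"
        using growth_condition_margin[OF assms(8) pos] by blast
      have shift: "real k * \<beta> k * norm (V (z k)) \<le> 2 * (real k * \<beta> (k - 1) * norm (V (z k)))"
        if k: "k \<ge> 1" "real k \<ge> 2 * \<alpha>" for k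
      proof -
        have "(\<alpha> - 2 - \<epsilon>) * \<beta> k \<le> (real k / 2) * \<beta> k"
          using k \<epsilon> pos[of k] by (intro mult_right_mono) auto
        hence "real k * \<beta> k \<le> 2 * (real k * \<beta> (k - 1))"
          using growth[OF k(1)] by (simp add: algebra_simps)
        hence "real k * \<beta> k * norm (V (z k)) \<le> 2 * (real k * \<beta> (k - 1)) * norm (V (z k))"
          by (rule mult_right_mono) simp
        thus ?thesis by simp
      qed
      have "\<forall>\<^sub>F k in sequentially. real k \<ge> 2 * \<alpha>"
        using filterlim_real_sequentially by (simp add: filterlim_at_top)
      thus ?thesis
        using eventually_ge_at_top[of 1] by eventually_elim (rule shift)
    qed
  qed

  have V_null': "(\<lambda>k. (real k * \<beta> k) *\<^sub>R V (z k)) \<longlonglongrightarrow> 0"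
    using V_null pos by (subst tendsto_norm_zero_iff[symmetric]) (simp add: abs_mult less_imp_le)
  have gap_null: "(\<lambda>k. inner (z k - z_star) ((real k * \<beta> k) *\<^sub>R V (z k))) \<longlonglongrightarrow> 0"
    using bounded_bilinear.Bfun_prod_Zfun[OF bounded_bilinear_inner null(3)] V_null'
    by (simp only: tendsto_Zfun_iff diff_0_right)

  have "(\<lambda>k. norm (z k - z (k - 1))) \<in> o(\<lambda>k. 1 / real k)"
  proof (rule smalloI_tendsto)
    show "(\<lambda>k. norm (z k - z (k - 1)) / (1 / real k)) \<longlonglongrightarrow> 0"
      using null(1) by (simp add: mult.commute)
    show "\<forall>\<^sub>F k in sequentially. 1 / real k \<noteq> 0"
      using eventually_gt_at_top[of 0] by eventually_elim simp
  qed
  moreover have "\<forall>\<^sub>F k in sequentially. 1 / (real k * \<beta> k) \<noteq> 0"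
    using eventually_gt_at_top[of 0] by eventually_elim (use pos in \<open>simp add: less_imp_neq[symmetric]\<close>)
  moreover have "(\<lambda>k. inner (z k - z_star) (V (z k)) / (1 / (real k * \<beta> k))) \<longlonglongrightarrow> 0"
    using gap_null by (simp add: mult_ac)
  moreover have "(\<lambda>k. norm (V (z k)) / (1 / (real k * \<beta> k))) \<longlonglongrightarrow> 0"
    using V_null by (simp add: mult_ac)
  ultimately show ?thesis
    by (auto intro: smalloI_tendsto)
qed

end
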